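(* For all positive integers $n,k$ with $k\geq 2$, $$\phi_k n^2\leq d_{n,k}\leq \phi_k n^2+\frac{(1+\phi_k)n}{2}+\frac14.$$ In particular, $\lim\limits_{n\to\infty}\dfrac{d_{n,k}}{\phi_k n^2}=1$ for each $k\geq 2$.
   Context: For an integer $k\geq 2$, $\phi_k=\frac14\cos^{-2}\bigl(\frac{\pi}{k+1}\bigr)=\frac{1}{4\cos^2(\pi/(k+1))}$. For integers $n\geq 1$ and $k\geq 2$, $$d_{n,k}=\min_{n=a_1+\dots+a_{k-1}}\ \max_{1\leq j\leq k-1}(a_1+\dots+a_j)(a_j+\dots+a_{k-1}),$$ where the minimum is over all tuples $(a_1,\dots,a_{k-1})$ of non-negative integers with sum $n$. *)

theory Defs
  imports Complex_Main
begin

definition phi :: "nat \<Rightarrow> real" where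
  "phi k = 1 / (4 * (cos (pi / (real k + 1)))\<^sup>2)"

text \<open>
  A tuple is given by a function on the naturals, of which only the values at the
  indices 1, ..., k - 1 matter. There are infinitely many such functions, but only finitely many
  values to minimise over (dvals_finite_nonempty), so that Min is a genuine minimum.
\<close>

definition dvals :: "nat \<Rightarrow> nat \<Rightarrow> nat set" where
  "dvals n k =
     {Max ((\<lambda>j. (\<Sum>i=1..j. a i) * (\<Sum>i=j..k - 1. a i)) ` {1..k - 1}) | a :: nat \<Rightarrow> nat.
        (\<Sum>i=1..k - 1. a i) = n}"

definition dmin :: "nat \<Rightarrow> nat \<Rightarrow> nat" where
  "dmin n k = Min (dvals n k)"

lemma dvals_finite_nonempty:
  assumes "k \<ge> 2"
  shows "finite (dvals n k)" and "dvals n k \<noteq> {}"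
proof -
  have "dvals n k \<subseteq> {..n * n}"
  proof
    fix v assume "v \<in> dvals n k"
    then obtain a :: "nat \<Rightarrow> nat" where s: "(\<Sum>i=1..k - 1. a i) = n"
      and v: "v = Max ((\<lambda>j. (\<Sum>i=1..j. a i) * (\<Sum>i=j..k - 1. a i)) ` {1..k - 1})"
      unfolding dvals_def by blast
    have "(\<Sum>i=1..j. a i) * (\<Sum>i=j..k - 1. a i) \<le> n * n" if "j \<in> {1..k - 1}" for j
      unfolding s[symmetric] using that by (intro mult_mono sum_mono2) auto
    then show "v \<in> {..n * n}"
      using assms unfolding v by (simp add: Max_le_iff)
  qed
  then show "finite (dvals n k)"
    using finite_subset by blast
  have "(\<Sum>i=1..k - 1. if i = 1 then n else 0) = n"
    using assms by (auto simp: sum.delta)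
  then show "dvals n k \<noteq> {}"
    unfolding dvals_def by blast
qed

end

theory Submission
  imports Defs
begin

text \<open>
  In terms of the partial sums \<open>S\<^sub>j\<close>, the quantities to compare are \<open>S\<^sub>j (n - S\<^sub>j\<^sub>-\<^sub>1)\<close>. Over the
  reals they can all be made equal to \<open>\<phi>\<^sub>k n\<^sup>2\<close>, by taking \<open>S\<^sub>j = n s\<^sub>j\<close> with \<open>s\<^sub>0 = 0\<close> and
  \<open>s\<^sub>j (1 - s\<^sub>j\<^sub>-\<^sub>1) = \<phi>\<^sub>k\<close>; this recursion is solved by a quotient of sines and reaches
  \<open>s\<^sub>k\<^sub>-\<^sub>1 = 1\<close>. If every product were smaller than \<open>\<phi>\<^sub>k n\<^sup>2\<close>, induction would give
  \<open>S\<^sub>j < n s\<^sub>j\<close>, contradicting \<open>S\<^sub>k\<^sub>-\<^sub>1 = n\<close>. For the upper bound, round every \<open>n s\<^sub>j\<close> to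
  the nearest integer.
\<close>

section \<open>The real solution of the balancing recursion\<close>

text \<open>The closed form of the numbers \<open>s\<^sub>j\<close>. Only indices
  \<open>j < k\<close> are meaningful: at \<open>j = k\<close> the denominator contains sin pi =
  0.\<close>

definition balanced :: "nat \<Rightarrow> nat \<Rightarrow> real" where
  "balanced k j = sin (real j * (pi / (real k + 1))) /
     (2 * cos (pi / (real k + 1)) * sin (real (Suc j) * (pi / (real k + 1))))"

lemma cos_angle_pos:
  assumes "k \<ge> 2"
  shows "cos (pi / (real k + 1)) > 0"
  using assms by (intro cos_gt_zero) (auto simp: field_simps)

lemma sin_multiple_pos:
  assumes "0 < j" "j \<le> k"
  shows "sin (real j * (pi / (real k + 1))) > 0"
proof (rule sin_gt_zero)
  have "real j * pi < (real k + 1) * pi"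
    using assms by (intro mult_strict_right_mono) auto
  then show "real j * (pi / (real k + 1)) < pi"
    by (simp add: field_simps)
qed (use assms in simp)

lemma phi_pos: "k \<ge> 2 \<Longrightarrow> phi k > 0"
  using cos_angle_pos[of k] by (simp add: phi_def)

lemma phi_ge_quarter: "k \<ge> 2 \<Longrightarrow> phi k \<ge> 1 / 4"
  using cos_angle_pos[of k] by (simp add: phi_def field_simps power_le_one)

lemma balanced_0 [simp]: "balanced k 0 = 0"
  by (simp add: balanced_def)

text \<open>With t = pi / (k + 1), the identity sin((j+2)t) + sin(jt) = 2 cos t sin((j+1)t) gives
  the complement the same shape as \<open>balanced\<close>, so that products of the two
  cancel.\<close>

lemma one_minus_balanced:
  assumes "k \<ge> 2" "j < k"
  shows "1 - balanced k j = sin (real (j + 2) * (pi / (real k + 1))) /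
     (2 * cos (pi / (real k + 1)) * sin (real (Suc j) * (pi / (real k + 1))))"
proof -
  define t where "t = pi / (real k + 1)"
  have c: "cos t > 0" and s: "sin (real (Suc j) * t) > 0"
    using assms cos_angle_pos sin_multiple_pos[of "Suc j" k] unfolding t_def by auto
  have "real (j + 2) * t = real (Suc j) * t + t" "real j * t = real (Suc j) * t - t"
    by (simp_all add: algebra_simps)
  then have "sin (real (j + 2) * t) + sin (real j * t) = 2 * cos t * sin (real (Suc j) * t)"
    by (simp only: sin_add sin_diff) simp
  then show ?thesis
    unfolding balanced_def t_def[symmetric] using c s by (simp add: divide_simps)
qed

text \<open>The numerator of each factor cancels the sine in the denominator of the other, leaving
  only the two factors 1 / (2 cos t).\<close>

lemma balanced_step:
  assumes "k \<ge> 2" "Suc j < k"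
  shows "balanced k (Suc j) * (1 - balanced k j) = phi k"
proof -
  have "sin (real (Suc j) * (pi / (real k + 1))) > 0" "sin (real (j + 2) * (pi / (real k + 1))) > 0"
    using assms by (intro sin_multiple_pos; simp)+
  then show ?thesis
    unfolding one_minus_balanced[OF assms(1) Suc_lessD[OF assms(2)]]
    using cos_angle_pos[OF assms(1)]
    by (simp add: balanced_def phi_def power2_eq_square del: of_nat_Suc of_nat_add)
qed

lemma balanced_nonneg:
  assumes "k \<ge> 2" "j < k"
  shows "0 \<le> balanced k j"
  using assms cos_angle_pos[of k] sin_multiple_pos[of j k] sin_multiple_pos[of "Suc j" k]
  by (cases "j = 0") (auto simp: balanced_def intro!: divide_nonneg_pos simp del: of_nat_Suc)

lemma balanced_less_1:
  assumes "k \<ge> 2" "Suc j < k"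
  shows "balanced k j < 1"
proof -
  have "1 - balanced k j > 0"
    unfolding one_minus_balanced[OF assms(1) Suc_lessD[OF assms(2)]] using assms
    by (intro divide_pos_pos mult_pos_pos cos_angle_pos sin_multiple_pos) auto
  then show ?thesis by simp
qed

text \<open>The numerator of the complement becomes sin pi = 0.\<close>

lemma balanced_last:
  assumes "k \<ge> 2"
  shows "balanced k (k - 1) = 1"
proof -
  have "real (k - 1 + 2) * (pi / (real k + 1)) = pi"
    using assms by (simp add: of_nat_diff add.commute)
  then show ?thesis
    using one_minus_balanced[of k "k - 1"] assms by simp
qed

lemma balanced_le_1:
  assumes "k \<ge> 2" "j < k"
  shows "balanced k j \<le> 1"
  using balanced_less_1[of k j] balanced_last[of k] assms
  by (cases "Suc j = k") (auto simp: less_imp_le)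

text \<open>By AM-GM: \<open>x\<close> and \<open>y\<close> are nonnegative with product
  \<open>phi k\<close>, at least 1/4, so their sum is at least 1. This keeps the rounded partial
  sums in order.\<close>

lemma balanced_mono:
  assumes "k \<ge> 2" "Suc j < k"
  shows "balanced k j \<le> balanced k (Suc j)"
proof -
  define x y where "x = balanced k (Suc j)" and "y = 1 - balanced k j"
  have "0 \<le> x" "0 \<le> y"
    using assms balanced_nonneg[of k "Suc j"] balanced_less_1[of k j] by (auto simp: x_def y_def)
  have "(1::real)\<^sup>2 \<le> 4 * phi k"
    using phi_ge_quarter[OF assms(1)] by simp
  also have "\<dots> = 4 * (x * y)"
    using balanced_step[OF assms] by (simp add: x_def y_def)
  also have "\<dots> \<le> (x + y)\<^sup>2"
    using zero_le_power2[of "x - y"] by (simp add: power2_eq_square algebra_simps)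
  finally have "1\<^sup>2 \<le> (x + y)\<^sup>2" .
  then have "1 \<le> x + y"
    by (rule power2_le_imp_le) (use \<open>0 \<le> x\<close> \<open>0 \<le> y\<close> in simp)
  then show ?thesis by (simp add: x_def y_def)
qed

text \<open>The slack is exactly \<open>(1 - balanced k (Suc j)) * balanced k j\<close>. This
  estimate produces the coefficient \<open>(1 + phi k) / 2\<close> of the linear error term.\<close>

lemma balanced_increment_le:
  assumes "k \<ge> 2" "Suc j < k"
  shows "balanced k (Suc j) - balanced k j \<le> phi k"
proof -
  have "0 \<le> (1 - balanced k (Suc j)) * balanced k j"
    using balanced_le_1[of k "Suc j"] balanced_nonneg[of k j] assms by simp
  also have "\<dots> = phi k - (balanced k (Suc j) - balanced k j)"
    using balanced_step[OF assms] by (simp add: algebra_simps)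
  finally show ?thesis by simp
qed

section \<open>Lower bound\<close>

lemma tail_sum:
  fixes a :: "nat \<Rightarrow> nat"
  assumes "j < m"
  shows "real (\<Sum>i=Suc j..m. a i) = real (\<Sum>i=1..m. a i) - real (\<Sum>i=1..j. a i)"
proof -
  have "(\<Sum>i=1..m. a i) = (\<Sum>i=1..j. a i) + (\<Sum>i=Suc j..m. a i)"
    using sum.ub_add_nat[of 1 j a "m - j"] assms by simp
  then show ?thesis by simp
qed

lemma exists_large_product:
  fixes a :: "nat \<Rightarrow> nat"
  assumes k: "k \<ge> 2" and n: "n \<ge> 1" and a: "(\<Sum>i=1..k - 1. a i) = n"
  shows "\<exists>j\<in>{1..k - 1}. phi k * (real n)\<^sup>2 \<le> real ((\<Sum>i=1..j. a i) * (\<Sum>i=j..k - 1. a i))"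
proof (rule ccontr)
  define S where "S j = (\<Sum>i=1..j. a i)" for j
  assume "\<not> ?thesis"
  then have *: "real ((\<Sum>i=1..j. a i) * (\<Sum>i=j..k - 1. a i)) < phi k * (real n)\<^sup>2"
    if "j \<in> {1..k - 1}" for j
    using that not_le by blast
  have small: "real (S (Suc j)) * (real n - real (S j)) < phi k * (real n)\<^sup>2" if "Suc j < k" for j
  proof -
    have "real n - real (S j) = real (\<Sum>i=Suc j..k - 1. a i)"
      using tail_sum[of j "k - 1" a] a that by (simp only: S_def)
    then show ?thesis
      using *[of "Suc j"] that by (simp add: S_def del: of_nat_sum sum.cl_ivl_Suc)
  qed
  \<comment> \<open>Strictness fails at \<open>j = 0\<close>, where both sides vanish. The weak
    inequality suffices as induction hypothesis; the strict one is what contradicts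
    \<open>S (k - 1) = n\<close>.\<close>
  have bound: "real (S j) \<le> real n * balanced k j \<and> (0 < j \<longrightarrow> real (S j) < real n * balanced k j)"
    if "j < k" for j
    using that
  proof (induction j)
    case 0
    then show ?case by (simp add: S_def)
  next
    case (Suc j)
    define y where "y = real n * (1 - balanced k j)"
    have y: "y > 0"
      using balanced_less_1[of k j] Suc.prems k n by (simp add: y_def)
    \<comment> \<open>The induction hypothesis makes \<open>y\<close> a lower bound for
      \<open>n - S j\<close>; since \<open>y > 0\<close>, it can be cancelled at the end.\<close>
    have "real (S (Suc j)) * y \<le> real (S (Suc j)) * (real n - real (S j))"
      using Suc by (intro mult_left_mono) (auto simp: y_def algebra_simps)
    also have "\<dots> < phi k * (real n)\<^sup>2"
      using small Suc.prems by blast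
    also have "\<dots> = real n * balanced k (Suc j) * y"
      using balanced_step[of k j] k Suc.prems
      by (simp add: y_def power2_eq_square mult.assoc mult.left_commute)
    finally show ?case
      using y by (simp add: mult_less_cancel_right)
  qed
  show False
    using bound[of "k - 1"] balanced_last[OF k] a k by (simp add: S_def del: of_nat_sum)
qed

lemma dmin_lower:
  assumes "k \<ge> 2" "n \<ge> 1"
  shows "phi k * (real n)\<^sup>2 \<le> real (dmin n k)"
proof -
  have "dmin n k \<in> dvals n k"
    unfolding dmin_def using dvals_finite_nonempty assms by (intro Min_in) auto
  then obtain a where a: "(\<Sum>i=1..k - 1. a i) = n"
    and d: "dmin n k = Max ((\<lambda>j. (\<Sum>i=1..j. a i) * (\<Sum>i=j..k - 1. a i)) ` {1..k - 1})"
    unfolding dvals_def by blast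
  obtain j where j: "j \<in> {1..k - 1}"
    and le: "phi k * (real n)\<^sup>2 \<le> real ((\<Sum>i=1..j. a i) * (\<Sum>i=j..k - 1. a i))"
    using exists_large_product[OF assms a] by blast
  have "(\<Sum>i=1..j. a i) * (\<Sum>i=j..k - 1. a i) \<le> dmin n k"
    unfolding d using j by (intro Max_ge) auto
  with le show ?thesis
    by (meson of_nat_le_iff order_trans)
qed

section \<open>Upper bound\<close>

text \<open>Tuples correspond to nondecreasing sequences of partial sums from 0 to \<open>n\<close>,
  so a good tuple can be given by its partial sums.\<close>

lemma dmin_le_partial_sums:
  fixes S :: "nat \<Rightarrow> nat" and B :: real
  assumes k: "k \<ge> 2" and S0: "S 0 = 0" and Sn: "S (k - 1) = n"
    and mono: "\<And>j. Suc j < k \<Longrightarrow> S j \<le> S (Suc j)"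
    and B: "\<And>j. Suc j < k \<Longrightarrow> real (S (Suc j)) * (real n - real (S j)) \<le> B"
  shows "real (dmin n k) \<le> B"
proof -
  \<comment> \<open>Truncated subtraction is harmless for \<open>1 \<le> i < k\<close> because
    \<open>S\<close> is monotone there.\<close>
  define a where "a i = S i - S (i - 1)" for i
  define f where "f j = (\<Sum>i=1..j. a i) * (\<Sum>i=j..k - 1. a i)" for j
  have sum_a: "(\<Sum>i=1..j. a i) = S j" if "j < k" for j
    using that by (induction j) (use mono in \<open>auto simp: S0 a_def\<close>)
  have a: "(\<Sum>i=1..k - 1. a i) = n"
    using sum_a[of "k - 1"] Sn k by simp
  have f: "real (f j) \<le> B" if j: "j \<in> {1..k - 1}" for j
  proof -
    obtain i where i: "j = Suc i" "Suc i < k"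
      using j by (cases j) auto
    have "real (\<Sum>l=j..k - 1. a l) = real n - real (S i)" "(\<Sum>l=1..j. a l) = S j"
      using tail_sum[of i "k - 1" a] a sum_a[of i] sum_a[of j] i by (auto simp del: of_nat_sum)
    then show ?thesis
      using B[OF i(2)] i by (simp only: f_def of_nat_mult)
  qed
  have "Max (f ` {1..k - 1}) \<in> f ` {1..k - 1}"
    using k by (intro Max_in) auto
  then have "real (Max (f ` {1..k - 1})) \<le> B"
    using f by auto
  moreover have "Max (f ` {1..k - 1}) \<in> dvals n k"
    unfolding dvals_def f_def using a by blast
  then have "dmin n k \<le> Max (f ` {1..k - 1})"
    unfolding dmin_def using dvals_finite_nonempty[OF k] by (intro Min_le) auto
  ultimately show ?thesis
    by linarith
qed

lemma dmin_upper:
  assumes k: "k \<ge> 2"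
  shows "real (dmin n k) \<le> phi k * (real n)\<^sup>2 + (1 + phi k) * real n / 2 + 1 / 4"
proof -
  define S where "S j = nat (round (real n * balanced k j))" for j
  \<comment> \<open>Nonnegativity of \<open>balanced\<close> ensures that \<open>nat\<close> does
    not cut off the rounded value.\<close>
  have S: "real (S j) = of_int (round (real n * balanced k j))" if "j < k" for j
  proof -
    have "round (0::real) \<le> round (real n * balanced k j)"
      using balanced_nonneg[OF k that] by (intro round_mono) simp
    then show ?thesis by (simp add: S_def)
  qed
  show ?thesis
  proof (rule dmin_le_partial_sums[OF k, where S = S])
    \<comment> \<open>Both end values, 0 and \<open>n\<close>, are already integers, so rounding
      leaves them fixed.\<close>
    show "S 0 = 0" "S (k - 1) = n"
      using balanced_last[OF k] by (simp_all add: S_def)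
  next
    fix j assume j: "Suc j < k"
    show "S j \<le> S (Suc j)"
      unfolding S_def using balanced_mono[OF k j] by (intro nat_mono round_mono mult_left_mono) auto
    define x y where "x = balanced k (Suc j)" and "y = 1 - balanced k j"
    have xy: "x * y = phi k" "x + y \<le> 1 + phi k" "0 \<le> x" "0 \<le> y"
      using balanced_step[OF k j] balanced_increment_le[OF k j] balanced_nonneg[OF k j]
        balanced_less_1[OF k j] by (auto simp: x_def y_def)
    have upper: "real (S (Suc j)) \<le> real n * x + 1 / 2"
      using of_int_round_le[of "real n * x"] S[OF j] by (simp add: x_def)
    have lower: "real n - real (S j) \<le> real n * y + 1 / 2"
      using of_int_round_ge[of "real n * balanced k j"] S[of j] j
      by (simp add: y_def algebra_simps)
    have "real (S (Suc j)) * (real n - real (S j)) \<le> real (S (Suc j)) * (real n * y + 1 / 2)"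
      using lower by (intro mult_left_mono) auto
    \<comment> \<open>Each factor carries a rounding error of at most 1/2; expanding gives the
      linear term \<open>(x + y) * n / 2\<close> and the constant 1/4.\<close>
    also have "\<dots> \<le> (real n * x + 1 / 2) * (real n * y + 1 / 2)"
      using upper xy by (intro mult_right_mono) auto
    also have "\<dots> = x * y * (real n)\<^sup>2 + (x + y) * real n / 2 + 1 / 4"
      by (simp add: power2_eq_square field_simps)
    also have "\<dots> \<le> phi k * (real n)\<^sup>2 + (1 + phi k) * real n / 2 + 1 / 4"
      using xy by (simp add: mult_right_mono)
    finally show "real (S (Suc j)) * (real n - real (S j)) \<le>
        phi k * (real n)\<^sup>2 + (1 + phi k) * real n / 2 + 1 / 4" .
  qed
qed

section \<open>Limit\<close>

lemma dmin_ratio_tendsto: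
  assumes k: "k \<ge> 2"
  shows "(\<lambda>n. real (dmin n k) / (phi k * (real n)\<^sup>2)) \<longlonglongrightarrow> 1"
proof (rule tendsto_sandwich)
  have pos: "phi k > 0" using phi_pos[OF k] .
  \<comment> \<open>The upper bound divided by \<open>phi k * n\<^sup>2\<close>, written in powers
    of \<open>inverse n\<close>; the two agree for \<open>n \<ge> 1\<close>.\<close>
  let ?u = "\<lambda>n. 1 + (1 + phi k) / (2 * phi k) * inverse (real n) + 1 / (4 * phi k) * (inverse (real n))\<^sup>2"
  show "\<forall>\<^sub>F n in sequentially. 1 \<le> real (dmin n k) / (phi k * (real n)\<^sup>2)"
    using eventually_ge_at_top[of 1]
    by eventually_elim (use dmin_lower[OF k] pos in \<open>simp add: le_divide_eq\<close>)
  show "\<forall>\<^sub>F n in sequentially. real (dmin n k) / (phi k * (real n)\<^sup>2) \<le> ?u n"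
    using eventually_ge_at_top[of 1]
  proof eventually_elim
    case (elim n)
    have "real (dmin n k) / (phi k * (real n)\<^sup>2)
        \<le> (phi k * (real n)\<^sup>2 + (1 + phi k) * real n / 2 + 1 / 4) / (phi k * (real n)\<^sup>2)"
      using dmin_upper[OF k] pos by (intro divide_right_mono) auto
    also have "\<dots> = ?u n"
      using elim pos by (simp add: field_simps power2_eq_square)
    finally show ?case .
  qed
  have "?u \<longlonglongrightarrow> 1 + (1 + phi k) / (2 * phi k) * 0 + 1 / (4 * phi k) * 0\<^sup>2"
    by (intro tendsto_intros lim_inverse_n)
  then show "?u \<longlonglongrightarrow> 1" by simp
qed simp

theorem lemma1p2:
  "(\<forall>n k :: nat. n \<ge> 1 \<and> k \<ge> 2 \<longrightarrow>
      phi k * (real n)\<^sup>2 \<le> real (dmin n k) \<and>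
      real (dmin n k) \<le> phi k * (real n)\<^sup>2 + (1 + phi k) * real n / 2 + 1 / 4) \<and>
   (\<forall>k :: nat. k \<ge> 2 \<longrightarrow>
      (\<lambda>n. real (dmin n k) / (phi k * (real n)\<^sup>2)) \<longlonglongrightarrow> 1)"
  using dmin_lower dmin_upper dmin_ratio_tendsto by blast

end
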